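(* Let $\Bbbk$ be an algebraically closed field of characteristic zero, let $G=\mathbb{Z}_{m_1}\times\cdots\times\mathbb{Z}_{m_n}$ with $m_i\mid m_{i+1}$ for $1\le i\le n-1$ and with fixed generators $g_1,\dots,g_n$ of the factors, and let $\omega$ be the normalized $3$-cocycle on $G$ $$\omega(g_1^{i_1}\cdots g_n^{i_n},g_1^{j_1}\cdots g_n^{j_n},g_1^{k_1}\cdots g_n^{k_n})=\prod_{r=1}^n\zeta_{m_r}^{a_r i_r[\frac{j_r+k_r}{m_r}]}\prod_{1\le r<s\le n}\zeta_{m_r}^{a_{rs}k_r[\frac{i_s+j_s}{m_s}]}\prod_{1\le r<s<t\le n}\zeta_{m_r}^{-a_{rst}k_rj_si_t}$$ ($0\le i_r,j_r,k_r<m_r$), where $a_r,a_{rs},a_{rst}$ are integers with $0\le a_r,a_{rs},a_{rst}<m_r$. Let $r_{ij}\in\Bbbk^*$ for $1\le i,j\le n$. Then there is a quasi-bicharacter $\mathcal{R}$ of $G$ with respect to $\omega$ satisfying $\mathcal{R}(g_i,g_j)=r_{ij}$ for all $1\le i,j\le n$ if and only if the following hold: $$r_{ii}^{m_i}=\zeta_{m_i}^{a_i}=\zeta_{m_i}^{-a_i}\quad\text{for }1\le i\le n,$$ $$r_{ij}^{m_i}=r_{ji}^{m_i}=1,\quad a_{ij}=0\quad\text{for }1\le i<j\le n,$$ $$a_{rst}=0\quad\text{for }1\le r<s<t\le n.$$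
   Context: $\Bbbk^*=\Bbbk\setminus\{0\}$; $\zeta_m$ is a fixed primitive $m$-th root of unity in $\Bbbk$; $[\frac{s}{r}]$ is the integer part. A quasi-bicharacter of $G$ with respect to a $3$-cocycle $\omega$ is a function $\mathcal{R}:G\times G\to\Bbbk^*$ such that for all $x,y,z\in G$ $$\frac{\mathcal{R}(xy,z)}{\mathcal{R}(x,z)\mathcal{R}(y,z)}\cdot\frac{\omega(x,z,y)}{\omega(x,y,z)\,\omega(z,x,y)}=1=\frac{\mathcal{R}(x,yz)}{\mathcal{R}(x,y)\mathcal{R}(x,z)}\cdot\frac{\omega(x,y,z)\,\omega(y,z,x)}{\omega(y,x,z)}.$$ (Equivalently, $c_{S_x,S_y}=\mathcal{R}(x,y)\,\mathrm{id}$ is a braiding on the linear Gr-category of finite-dimensional $G$-graded vector spaces with associativity constraint $\omega$, where $S_g$ is the one-dimensional space in degree $g$.) *)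

theory Defs
  imports
    "HOL-Computational_Algebra.Polynomial"
    "HOL-Algebra.FiniteProduct"
    "HOL-Algebra.Product_Groups"
begin

definition primitive_root_of_unity :: "nat \<Rightarrow> 'k::field \<Rightarrow> bool" where
  "primitive_root_of_unity m z \<longleftrightarrow>
     m > 0 \<and> z ^ m = 1 \<and> (\<forall>k. 0 < k \<and> k < m \<longrightarrow> z ^ k \<noteq> 1)"

text \<open>
  For positive \<open>m i\<close>, the group \<open>integer_mod_group (m i)\<close> has carrier \<open>{0..<int (m i)}\<close> with
  addition modulo \<open>m i\<close>; the product is written multiplicatively in the HOL-Algebra notation.
\<close>

abbreviation cyclic_product :: "nat \<Rightarrow> (nat \<Rightarrow> nat) \<Rightarrow> (nat \<Rightarrow> int) monoid" where
  "cyclic_product n m \<equiv> product_group {1..n} (\<lambda>i. integer_mod_group (m i))"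

text \<open>
  Here \<open>u i\<close> is a generator of the \<open>i\<close>-th factor, and \<open>factor_gen n m u i\<close> is its image
  under the inclusion of that factor into the product.
\<close>

definition is_factor_gens :: "nat \<Rightarrow> (nat \<Rightarrow> nat) \<Rightarrow> (nat \<Rightarrow> int) \<Rightarrow> bool" where
  "is_factor_gens n m u \<longleftrightarrow>
     (\<forall>i\<in>{1..n}. u i \<in> carrier (integer_mod_group (m i)) \<and>
        generate (integer_mod_group (m i)) {u i} = carrier (integer_mod_group (m i)))"

definition factor_gen :: "nat \<Rightarrow> (nat \<Rightarrow> nat) \<Rightarrow> (nat \<Rightarrow> int) \<Rightarrow> nat \<Rightarrow> (nat \<Rightarrow> int)" where
  "factor_gen n m u i =
     (\<lambda>j\<in>{1..n}. if j = i then u i else \<one>\<^bsub>integer_mod_group (m j)\<^esub>)"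

definition gen_monomial ::
    "nat \<Rightarrow> (nat \<Rightarrow> nat) \<Rightarrow> (nat \<Rightarrow> int) \<Rightarrow> (nat \<Rightarrow> int) \<Rightarrow> (nat \<Rightarrow> int)" where
  "gen_monomial n m u e =
     (\<Otimes>\<^bsub>cyclic_product n m\<^esub>r\<in>{1..n}. factor_gen n m u r [^]\<^bsub>cyclic_product n m\<^esub> e r)"

text \<open>Reduced exponents. Only the values at \<open>1, \<dots>, n\<close> are relevant.\<close>

definition exponents :: "nat \<Rightarrow> (nat \<Rightarrow> nat) \<Rightarrow> (nat \<Rightarrow> int) set" where
  "exponents n m = {e. \<forall>r\<in>{1..n}. 0 \<le> e r \<and> e r < int (m r)}"

definition cocycle_value ::
    "nat \<Rightarrow> (nat \<Rightarrow> nat) \<Rightarrow> (nat \<Rightarrow> 'k::field) \<Rightarrow>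
     (nat \<Rightarrow> int) \<Rightarrow> (nat \<Rightarrow> nat \<Rightarrow> int) \<Rightarrow> (nat \<Rightarrow> nat \<Rightarrow> nat \<Rightarrow> int) \<Rightarrow>
     (nat \<Rightarrow> int) \<Rightarrow> (nat \<Rightarrow> int) \<Rightarrow> (nat \<Rightarrow> int) \<Rightarrow> 'k" where
  "cocycle_value n m \<zeta> a b c i j k =
     (\<Prod>r\<in>{1..n}. \<zeta> (m r) powi (a r * i r * ((j r + k r) div int (m r)))) *
     (\<Prod>r\<in>{1..n}. \<Prod>s\<in>{r<..n}. \<zeta> (m r) powi (b r s * k r * ((i s + j s) div int (m s)))) *
     (\<Prod>r\<in>{1..n}. \<Prod>s\<in>{r<..n}. \<Prod>t\<in>{s<..n}. \<zeta> (m r) powi (- (c r s t * k r * j s * i t)))"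

definition quasi_bicharacter ::
    "('g, 'x) monoid_scheme \<Rightarrow> ('g \<Rightarrow> 'g \<Rightarrow> 'g \<Rightarrow> 'k::field) \<Rightarrow> ('g \<Rightarrow> 'g \<Rightarrow> 'k) \<Rightarrow> bool" where
  "quasi_bicharacter G \<omega> R \<longleftrightarrow>
     (\<forall>x\<in>carrier G. \<forall>y\<in>carrier G. R x y \<noteq> 0) \<and>
     (\<forall>x\<in>carrier G. \<forall>y\<in>carrier G. \<forall>z\<in>carrier G.
        R (x \<otimes>\<^bsub>G\<^esub> y) z / (R x z * R y z) * (\<omega> x z y / (\<omega> x y z * \<omega> z x y)) = 1 \<and>
        1 = R x (y \<otimes>\<^bsub>G\<^esub> z) / (R x y * R x z) * (\<omega> x y z * \<omega> y z x / \<omega> y x z))"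

end

theory Submission
  imports Defs
begin

text \<open>
  Write \<open>g\<^sub>i\<close> for \<open>factor_gen n m u i\<close>. On three powers of single generators at most one factor of
  \<open>\<omega>\<close> differs from \<open>1\<close>. It belongs to powers of \<open>(g\<^sub>p, g\<^sub>p, g\<^sub>p)\<close>, where \<open>a p\<close> governs it, of
  \<open>(g\<^sub>p, g\<^sub>p, g\<^sub>s)\<close> with \<open>s < p\<close>, where \<open>b s p\<close> does, or of \<open>(g\<^sub>t, g\<^sub>s, g\<^sub>r)\<close> with
  \<open>r < s < t\<close>, where \<open>c r s t\<close> does; in the first two cases it moreover needs a carry, that is, an
  addition of exponents that reaches \<open>m p\<close>. This is \<open>cocycle_value_axis\<close>.

  For necessity, the two braiding identities express \<open>R(g\<^sub>p\<^bsup>k+1\<^esup>, g\<^sub>q)\<close> and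
  \<open>R(g\<^sub>q, g\<^sub>p\<^bsup>k+1\<^esup>)\<close> through the value at \<open>k\<close>. The correction by \<open>\<omega>\<close> is trivial
  until the carry at \<open>k + 1 = m p\<close>, where the power has come back to the identity and \<open>R\<close>
  to \<open>1\<close>. Hence each \<open>R(g\<^sub>p, g\<^sub>q) ^ m p\<close> equals the inverse of the correction at the carry
  (\<open>R_power_left\<close>, \<open>R_power_right\<close>). For \<open>p = q\<close> the two sides give \<open>\<zeta>\<^bsup>-a\<^esup>\<close> and \<open>\<zeta>\<^bsup>a\<^esup>\<close>.
  For \<open>i < j\<close> they give \<open>\<rho> i j ^ m i = \<rho> j i ^ m i = 1\<close> and
  \<open>\<rho> j i ^ m j * \<zeta> (m i) powi b i j = 1\<close>; as \<open>m i dvd m j\<close>, the root of unity is \<open>1\<close> and so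
  \<open>b i j = 0\<close>. Finally \<open>\<omega>\<close> is not symmetric in \<open>g\<^sub>t, g\<^sub>s, g\<^sub>r\<close> unless \<open>c r s t = 0\<close>, but
  \<open>R(g\<^sub>t g\<^sub>s, g\<^sub>r) = R(g\<^sub>s g\<^sub>t, g\<^sub>r)\<close> because the group is abelian (\<open>triple_root_eq_1\<close>).

  For sufficiency, the bilinear expression \<open>\<Prod>i j. \<rho> i j powi (e i * f j)\<close> in the reduced
  exponents is a quasi-bicharacter (\<open>bicharacter_exists\<close>): it fails to be multiplicative only
  through carries. A carry in position \<open>i\<close> of the left or position \<open>j\<close> of the right argument costs a
  power of \<open>\<rho> i j ^ m i\<close> or \<open>\<rho> i j ^ m j\<close>. These are \<open>1\<close> off the diagonal and \<open>\<zeta> (m i) powi a i\<close>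
  on it, which is the contribution of \<open>\<omega>\<close>. The sign condition \<open>\<zeta>\<^bsup>2 a\<^esup> = 1\<close> reconciles the first
  identity, where \<open>\<omega>\<close> enters with the other sign.
\<close>

section \<open>Roots of unity and powers\<close>

lemma primitive_root_nonzero: "primitive_root_of_unity l z \<Longrightarrow> z \<noteq> 0"
  unfolding primitive_root_of_unity_def by (metis power_0_left less_irrefl zero_neq_one)

lemma primitive_root_powi_eq_1D:
  assumes "primitive_root_of_unity l z" "0 \<le> e" "e < int l" "z powi e = 1"
  shows "e = 0"
proof (rule ccontr)
  assume "e \<noteq> 0"
  then have "0 < nat e" "nat e < l"
    using assms by auto
  moreover have "z ^ nat e = 1"
    using assms by (simp add: power_int_nonneg_exp)
  ultimately show False
    using assms(1) unfolding primitive_root_of_unity_def by blast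
qed

text \<open>
  Applied to \<open>T k = R(g\<^sup>k, h)\<close> or \<open>T k = R(h, g\<^sup>k)\<close> for \<open>g\<close> of order \<open>N\<close>: only the last step,
  in which the exponent wraps around, carries the correction \<open>\<chi>\<close>.
\<close>

lemma power_of_cyclic_recursion:
  fixes T :: "nat \<Rightarrow> 'k :: comm_semiring_1"
  assumes "N > 0" "T 0 = 1" "T N = 1"
    and step: "\<And>k. k < N \<Longrightarrow> T (Suc k) = T k * r * (if Suc k = N then \<chi> else 1)"
  shows "r ^ N * \<chi> = 1"
proof -
  have "T k = r ^ k" if "k < N" for k
    using that
  proof (induction k)
    case (Suc k)
    then show ?case using step[of k] by (simp add: mult.commute)
  qed (simp add: assms)
  moreover obtain N' where "N = Suc N'"
    using assms(1) gr0_conv_Suc by blast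
  ultimately show ?thesis
    using step[of N'] assms(3) by (simp add: mult.commute)
qed

text \<open>
  The left-hand side is the root of unity that the cocycle formula yields for reduced exponents
  when the exponents \<open>k\<close> and \<open>1\<close> are added modulo \<open>M\<close>. The reductions matter only for trivial
  factors: if \<open>N = 1\<close> the exponent \<open>1\<close> reduces to \<open>0\<close>, and the equation survives because then \<open>z = 1\<close>.
\<close>

lemma powi_carry:
  fixes z :: "'k :: field"
  assumes "N dvd M" "k < M" "N = 1 \<Longrightarrow> z = 1"
  shows "z powi (e * (1 mod int N) * ((int k mod int M + 1 mod int M) div int M)) =
         (if Suc k = M then z powi e else 1)"
proof (cases "N = 1")
  case False
  then have M: "M > 1"
    using assms by (metis One_nat_def Suc_lessI dvd_1_iff_1 gr_zeroI not_less0)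
  have N: "N > 1"
    using False assms M by (metis One_nat_def Suc_lessI dvd_0_left gr_zeroI less_nat_zero_code)
  have "(int k + 1) div int M = (if Suc k = M then 1 else 0)"
    using assms(2) by (cases "Suc k = M") (auto simp: div_pos_pos_trivial add.commute)
  then show ?thesis
    using M N assms(2) by simp
qed (use assms in simp)

lemma powi_mod_mult:
  fixes x :: "'k :: field"
  assumes "x \<noteq> 0"
  shows "x powi ((k mod int N) * l) = x powi (k * l) / (x ^ N) powi ((k div int N) * l)"
proof -
  have "(k mod int N) * l = k * l - int N * ((k div int N) * l)"
    by (simp add: minus_div_mult_eq_mod[symmetric] algebra_simps)
  then show ?thesis
    using assms by (simp add: power_int_diff power_int_mult[of x "int N"])
qed

section \<open>The cocycle on powers of single generators\<close>

text \<open>The exponent vector of \<open>g\<^sub>i\<^sup>k\<close>.\<close>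

definition axis :: "nat \<Rightarrow> int \<Rightarrow> nat \<Rightarrow> int" where
  "axis i k = (\<lambda>j. if j = i then k else 0)"

text \<open>
  Keeping the extra condition \<open>P\<close> beside \<open>r = p\<close> lets one rule collapse the nested products of the
  cocycle one index at a time.
\<close>

lemma prod_if_eq_1:
  assumes "finite A"
  shows "(\<Prod>r\<in>A. if r = p \<and> P then X else (1 :: 'k :: comm_monoid_mult)) = (if p \<in> A \<and> P then X else 1)"
  by (cases P) (use assms in \<open>simp_all add: prod.delta\<close>)

text \<open>
  A factor of the cocycle survives only if all indices that occur in it hit the supports of the
  three vectors. A carry of reduced exponents needs both summands in the same position, which
  forces two of the three positions to agree.
\<close>

lemma cocycle_value_axis:
  fixes \<zeta> :: "nat \<Rightarrow> 'k :: field"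
  assumes pqs: "p \<in> {1..n}" "q \<in> {1..n}" "s \<in> {1..n}"
    and ranges: "0 \<le> x" "x < int (m p)" "0 \<le> y" "y < int (m q)" "0 \<le> z" "z < int (m s)"
  shows "cocycle_value n m \<zeta> a b c (axis p x) (axis q y) (axis s z) =
    (if q = p \<and> s = p then \<zeta> (m p) powi (a p * x * ((y + z) div int (m p))) else 1) *
    (if q = p \<and> s < p then \<zeta> (m s) powi (b s p * z * ((x + y) div int (m p))) else 1) *
    (if s < q \<and> q < p then \<zeta> (m s) powi (- (c s q p * z * y * x)) else 1)"
proof -
  have 1: "(\<Prod>r\<in>{1..n}. \<zeta> (m r) powi (a r * axis p x r * ((axis q y r + axis s z r) div int (m r)))) =
     (if q = p \<and> s = p then \<zeta> (m p) powi (a p * x * ((y + z) div int (m p))) else 1)"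
  proof -
    have "\<zeta> (m r) powi (a r * axis p x r * ((axis q y r + axis s z r) div int (m r))) =
      (if r = p \<and> q = p \<and> s = p then \<zeta> (m p) powi (a p * x * ((y + z) div int (m p))) else 1)" for r
      using ranges by (auto simp: axis_def div_pos_pos_trivial)
    then show ?thesis
      using pqs by (simp only: prod_if_eq_1 finite_atLeastAtMost) simp
  qed
  have 2: "(\<Prod>r\<in>{1..n}. \<Prod>t\<in>{r<..n}. \<zeta> (m r) powi (b r t * axis s z r * ((axis p x t + axis q y t) div int (m t)))) =
     (if q = p \<and> s < p then \<zeta> (m s) powi (b s p * z * ((x + y) div int (m p))) else 1)"
  proof -
    have *: "\<zeta> (m r) powi (b r t * axis s z r * ((axis p x t + axis q y t) div int (m t))) =
      (if t = p \<and> r = s \<and> q = p then \<zeta> (m s) powi (b s p * z * ((x + y) div int (m p))) else 1)" for r t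
      using ranges by (auto simp: axis_def div_pos_pos_trivial)
    have "(\<Prod>t\<in>{r<..n}. \<zeta> (m r) powi (b r t * axis s z r * ((axis p x t + axis q y t) div int (m t)))) =
      (if r = s \<and> q = p \<and> s < p then \<zeta> (m s) powi (b s p * z * ((x + y) div int (m p))) else 1)" for r
      unfolding * using pqs by (simp add: prod_if_eq_1)
    then show ?thesis
      using pqs by (simp only: prod_if_eq_1 finite_atLeastAtMost) simp
  qed
  have 3: "(\<Prod>r\<in>{1..n}. \<Prod>v\<in>{r<..n}. \<Prod>t\<in>{v<..n}. \<zeta> (m r) powi (- (c r v t * axis s z r * axis q y v * axis p x t))) =
     (if s < q \<and> q < p then \<zeta> (m s) powi (- (c s q p * z * y * x)) else 1)"
  proof -
    have *: "\<zeta> (m r) powi (- (c r v t * axis s z r * axis q y v * axis p x t)) =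
      (if t = p \<and> r = s \<and> v = q then \<zeta> (m s) powi (- (c s q p * z * y * x)) else 1)" for r v t
      by (auto simp: axis_def)
    have **: "(\<Prod>t\<in>{v<..n}. \<zeta> (m r) powi (- (c r v t * axis s z r * axis q y v * axis p x t))) =
      (if v = q \<and> r = s \<and> q < p then \<zeta> (m s) powi (- (c s q p * z * y * x)) else 1)" for r v
      unfolding * using pqs by (auto simp add: prod_if_eq_1)
    have "(\<Prod>v\<in>{r<..n}. \<Prod>t\<in>{v<..n}. \<zeta> (m r) powi (- (c r v t * axis s z r * axis q y v * axis p x t))) =
      (if r = s \<and> s < q \<and> q < p then \<zeta> (m s) powi (- (c s q p * z * y * x)) else 1)" for r
      unfolding ** using pqs by (auto simp add: prod_if_eq_1)
    then show ?thesis
      using pqs by (simp only: prod_if_eq_1 finite_atLeastAtMost) simp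
  qed
  show ?thesis
    unfolding cocycle_value_def 1 2 3 ..
qed

section \<open>Monomials in the generators\<close>

lemma product_group_finprod_apply:
  assumes "\<And>i. i \<in> I \<Longrightarrow> comm_group (G i)" "finite A"
    and "f \<in> A \<rightarrow> carrier (product_group I G)" "j \<in> I"
  shows "(\<Otimes>\<^bsub>product_group I G\<^esub>r\<in>A. f r) j = (\<Otimes>\<^bsub>G j\<^esub>r\<in>A. f r j)"
proof -
  have grp: "group (G i)" if "i \<in> I" for i
    using assms(1)[OF that] by (simp add: comm_group_def)
  interpret P: comm_group "product_group I G"
  proof (rule group.group_comm_groupI)
    show "group (product_group I G)" using grp by simp
    fix x y assume "x \<in> carrier (product_group I G)" "y \<in> carrier (product_group I G)"
    then show "x \<otimes>\<^bsub>product_group I G\<^esub> y = y \<otimes>\<^bsub>product_group I G\<^esub> x"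
      using assms(1) by (auto simp: PiE_iff comm_group_def comm_monoid.m_comm intro!: restrict_ext)
  qed
  interpret J: comm_group "G j" using assms by blast
  show ?thesis
    using assms(2,3)
  proof (induction A rule: finite_induct)
    case (insert r A)
    have "(\<lambda>r. f r j) \<in> insert r A \<rightarrow> carrier (G j)"
      using insert.prems \<open>j \<in> I\<close> by (auto simp: PiE_iff Pi_iff)
    moreover have "f \<in> A \<rightarrow> carrier (product_group I G)" "f r \<in> carrier (product_group I G)"
      using insert.prems by auto
    ultimately show ?case
      using insert.hyps insert.IH \<open>j \<in> I\<close> by (simp del: carrier_product_group)
  qed (use assms in simp)
qed

lemma product_group_int_pow_apply:
  assumes "\<And>i. i \<in> I \<Longrightarrow> group (G i)" "x \<in> carrier (product_group I G)" "j \<in> I"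
  shows "(x [^]\<^bsub>product_group I G\<^esub> (k :: int)) j = x j [^]\<^bsub>G j\<^esub> k"
proof -
  have "(\<lambda>y. y j) \<in> hom (product_group I G) (G j)"
    using assms(3) by (auto simp: hom_def PiE_iff)
  then interpret group_hom "product_group I G" "G j" "\<lambda>y. y j"
    using assms by (simp add: group_hom_def group_hom_axioms_def)
  show ?thesis using assms(2) by (rule hom_int_pow)
qed

text \<open>A generator of the additive group \<open>\<int>/M\<close> has the element \<open>1\<close> among its multiples.\<close>

lemma integer_mod_group_generator_unit:
  assumes "M > 0" "w \<in> carrier (integer_mod_group M)"
    and gen: "generate (integer_mod_group M) {w} = carrier (integer_mod_group M)"
  obtains v where "(v * w) mod int M = 1 mod int M"
proof -
  have "1 mod int M \<in> carrier (integer_mod_group M)"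
    using assms(1) by (simp add: carrier_integer_mod_group)
  then show ?thesis
    using that unfolding gen[symmetric] group.generate_pow[OF group_integer_mod_group assms(2)]
    by (auto simp: int_pow_integer_mod_group)
qed

locale cyclic_product_gens =
  fixes n :: nat and m :: "nat \<Rightarrow> nat" and u :: "nat \<Rightarrow> int"
  assumes m_pos: "\<And>i. i \<in> {1..n} \<Longrightarrow> m i > 0"
    and gens: "is_factor_gens n m u"
begin

abbreviation G where "G \<equiv> cyclic_product n m"
abbreviation mon where "mon \<equiv> gen_monomial n m u"

lemma u_range: "i \<in> {1..n} \<Longrightarrow> 0 \<le> u i \<and> u i < int (m i)"
  using gens m_pos[of i] unfolding is_factor_gens_def by (force simp: carrier_integer_mod_group)

lemma factor_gen_closed: "factor_gen n m u i \<in> carrier G"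
  using gens by (auto simp: is_factor_gens_def factor_gen_def)

lemma group_G: "group G"
  by simp

text \<open>
  In coordinates a monomial is a rescaling of its exponent vector by the units \<open>u j\<close>. All that is needed
  about monomials follows from this: they add exponents, depend only on the exponents modulo \<open>m\<close>,
  and by \<open>generator_inverse\<close> exponents modulo \<open>m\<close> and group elements correspond bijectively.
\<close>

lemma mon_eq: "mon e = (\<lambda>j\<in>{1..n}. (u j * e j) mod int (m j))"
proof -
  interpret group G by (rule group_G)
  have cl: "(\<lambda>r. factor_gen n m u r [^]\<^bsub>G\<^esub> e r) \<in> {1..n} \<rightarrow> carrier G"
    using factor_gen_closed int_pow_closed by blast
  have "comm_group G"
    by (rule group_comm_groupI) (auto simp: add.commute)
  then interpret GC: comm_group G .
  have "mon e \<in> carrier G"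
    unfolding gen_monomial_def using cl by (rule GC.finprod_closed)
  moreover have "mon e j = (u j * e j) mod int (m j)" if j: "j \<in> {1..n}" for j
  proof -
    interpret J: comm_group "integer_mod_group (m j)" by simp
    have "mon e j = (\<Otimes>\<^bsub>integer_mod_group (m j)\<^esub>r\<in>{1..n}. (factor_gen n m u r [^]\<^bsub>G\<^esub> e r) j)"
      unfolding gen_monomial_def using cl j by (intro product_group_finprod_apply) auto
    also have "\<dots> = (\<Otimes>\<^bsub>integer_mod_group (m j)\<^esub>r\<in>{1..n}.
                   if r = j then (u r * e r) mod int (m j) else \<one>\<^bsub>integer_mod_group (m j)\<^esub>)"
    proof (rule J.finprod_cong')
      fix r assume "r \<in> {1..n}"
      have "(factor_gen n m u r [^]\<^bsub>G\<^esub> e r) j = factor_gen n m u r j [^]\<^bsub>integer_mod_group (m j)\<^esub> e r"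
        using factor_gen_closed j by (intro product_group_int_pow_apply) auto
      then show "(factor_gen n m u r [^]\<^bsub>G\<^esub> e r) j =
          (if r = j then (u r * e r) mod int (m j) else \<one>\<^bsub>integer_mod_group (m j)\<^esub>)"
        using j by (simp add: factor_gen_def int_pow_integer_mod_group mult.commute)
    qed (use m_pos[OF j] in \<open>auto simp: carrier_integer_mod_group\<close>)
    also have "\<dots> = (u j * e j) mod int (m j)"
      using j m_pos[OF j]
      by (intro J.finprod_singleton_swap[where f = "\<lambda>r. (u r * e r) mod int (m j)"])
         (auto simp: carrier_integer_mod_group)
    finally show ?thesis .
  qed
  ultimately show ?thesis
    by (auto simp: PiE_iff extensional_def)
qed

lemma mon_closed: "mon e \<in> carrier G"
  using m_pos by (auto simp: mon_eq carrier_integer_mod_group)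

lemma mon_mult: "mon e \<otimes>\<^bsub>G\<^esub> mon f = mon (\<lambda>j. e j + f j)"
  by (auto simp: mon_eq distrib_left mod_add_eq)

lemma mon_cong: "(\<And>j. j \<in> {1..n} \<Longrightarrow> e j mod int (m j) = f j mod int (m j)) \<Longrightarrow> mon e = mon f"
  by (auto simp: mon_eq intro!: restrict_ext mod_mult_cong)

lemma factor_gen_eq_mon: "i \<in> {1..n} \<Longrightarrow> factor_gen n m u i = mon (axis i 1)"
  using u_range by (auto simp: mon_eq factor_gen_def axis_def intro!: restrict_ext)

lemma reduced_exponents: "(\<lambda>j. e j mod int (m j)) \<in> exponents n m"
  using m_pos by (auto simp: exponents_def)

lemma generator_inverse: "\<exists>v. \<forall>j\<in>{1..n}. (v j * u j) mod int (m j) = 1 mod int (m j)"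
proof -
  have "\<exists>v. (v * u j) mod int (m j) = 1 mod int (m j)" if "j \<in> {1..n}" for j
    using gens that m_pos[OF that] integer_mod_group_generator_unit[of "m j" "u j"]
    unfolding is_factor_gens_def by metis
  then show ?thesis by metis
qed

lemma mon_surj:
  assumes "x \<in> carrier G"
  obtains e where "e \<in> exponents n m" "x = mon e"
proof -
  obtain v where v: "\<And>j. j\<in>{1..n} \<Longrightarrow> (v j * u j) mod int (m j) = 1 mod int (m j)"
    using generator_inverse by blast
  have "x = mon (\<lambda>j. (v j * x j) mod int (m j))"
  proof (rule ext)
    fix j
    show "x j = mon (\<lambda>j. (v j * x j) mod int (m j)) j"
    proof (cases "j \<in> {1..n}")
      case True
      have "u j * (v j * x j mod int (m j)) mod int (m j) = ((v j * u j) mod int (m j) * x j) mod int (m j)"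
        by (simp add: mod_simps algebra_simps)
      also have "\<dots> = x j mod int (m j)"
        by (simp add: v[OF True] mod_simps)
      also have "\<dots> = x j"
      proof -
        have "x j \<in> carrier (integer_mod_group (m j))"
          using assms True by (auto simp: PiE_iff)
        then show ?thesis using m_pos[OF True] by (simp add: carrier_integer_mod_group)
      qed
      finally show ?thesis using True by (simp add: mon_eq)
    qed (use assms in \<open>auto simp: mon_eq PiE_iff extensional_def\<close>)
  qed
  then show ?thesis
    using that reduced_exponents[of "\<lambda>j. v j * x j"] by blast
qed

lemma mon_inj:
  assumes "mon e = mon f" "j \<in> {1..n}"
  shows "e j mod int (m j) = f j mod int (m j)"
proof -
  obtain v where v: "\<And>j. j\<in>{1..n} \<Longrightarrow> (v j * u j) mod int (m j) = 1 mod int (m j)"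
    using generator_inverse by blast
  have *: "v j * (u j * g j mod int (m j)) mod int (m j) = g j mod int (m j)" for g :: "nat \<Rightarrow> int"
  proof -
    have "v j * (u j * g j mod int (m j)) mod int (m j) = ((v j * u j) mod int (m j) * g j) mod int (m j)"
      by (simp add: mod_simps algebra_simps)
    then show ?thesis by (simp add: v[OF assms(2)] mod_simps)
  qed
  have "u j * e j mod int (m j) = u j * f j mod int (m j)"
    using fun_cong[OF assms(1), of j] assms(2) by (simp add: mon_eq)
  then show ?thesis using *[of e] *[of f] by simp
qed

end

section \<open>The cocycle as a function on the group\<close>

locale cyclic_product_cocycle = cyclic_product_gens n m u
  for n :: nat and m :: "nat \<Rightarrow> nat" and u :: "nat \<Rightarrow> int" +
  fixes \<zeta> :: "nat \<Rightarrow> 'k :: field"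
    and a :: "nat \<Rightarrow> int" and b :: "nat \<Rightarrow> nat \<Rightarrow> int" and c :: "nat \<Rightarrow> nat \<Rightarrow> nat \<Rightarrow> int"
    and \<omega> :: "(nat \<Rightarrow> int) \<Rightarrow> (nat \<Rightarrow> int) \<Rightarrow> (nat \<Rightarrow> int) \<Rightarrow> 'k"
  assumes zeta: "\<And>l. l > 0 \<Longrightarrow> primitive_root_of_unity l (\<zeta> l)"
    and m_dvd: "\<And>i. 1 \<le> i \<Longrightarrow> i < n \<Longrightarrow> m i dvd m (i + 1)"
    and omega: "\<And>i j k. i \<in> exponents n m \<Longrightarrow> j \<in> exponents n m \<Longrightarrow> k \<in> exponents n m \<Longrightarrow>
                  \<omega> (mon i) (mon j) (mon k) = cocycle_value n m \<zeta> a b c i j k"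
begin

lemma m_dvd_le:
  assumes "1 \<le> i" "i \<le> j" "j \<le> n"
  shows "m i dvd m j"
  using assms(2,3)
proof (induction j rule: dec_induct)
  case (step j)
  then show ?case using m_dvd[of j] assms(1) dvd_trans by fastforce
qed simp

lemma zeta_nz: "i \<in> {1..n} \<Longrightarrow> \<zeta> (m i) \<noteq> 0"
  using zeta primitive_root_nonzero m_pos by blast

lemma zeta_1: "m i = 1 \<Longrightarrow> \<zeta> (m i) = 1"
  using zeta[of 1] by (simp add: primitive_root_of_unity_def)

lemma omega_nz:
  assumes "x \<in> carrier G" "y \<in> carrier G" "z \<in> carrier G"
  shows "\<omega> x y z \<noteq> 0"
proof -
  obtain e f g where "e \<in> exponents n m" "f \<in> exponents n m" "g \<in> exponents n m"
    and "x = mon e" "y = mon f" "z = mon g"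
    using assms mon_surj by metis
  then show ?thesis
    using zeta_nz by (auto simp: omega cocycle_value_def)
qed

lemma mon_axis_mod:
  assumes "p \<in> {1..n}"
  shows "mon (axis p x) = mon (axis p (x mod int (m p)))"
  by (rule mon_cong) (auto simp: axis_def)

lemma axis_mod_exponents: "axis p (x mod int (m p)) \<in> exponents n m"
  using m_pos by (auto simp: exponents_def axis_def)

text \<open>
  The exponents are arbitrary integers here, so that also \<open>g\<^sub>p\<^sup>1\<close> is covered when \<open>m p = 1\<close> and
  the exponent \<open>1\<close> is not reduced.
\<close>

lemma omega_axis:
  assumes "p \<in> {1..n}" "q \<in> {1..n}" "s \<in> {1..n}"
  shows "\<omega> (mon (axis p x)) (mon (axis q y)) (mon (axis s z)) =
    (if q = p \<and> s = p
     then \<zeta> (m p) powi (a p * (x mod int (m p)) * ((y mod int (m p) + z mod int (m p)) div int (m p)))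
     else 1) *
    (if q = p \<and> s < p
     then \<zeta> (m s) powi (b s p * (z mod int (m s)) * ((x mod int (m p) + y mod int (m p)) div int (m p)))
     else 1) *
    (if s < q \<and> q < p
     then \<zeta> (m s) powi (- (c s q p * (z mod int (m s)) * (y mod int (m q)) * (x mod int (m p))))
     else 1)"
proof -
  have "\<omega> (mon (axis p x)) (mon (axis q y)) (mon (axis s z)) =
    cocycle_value n m \<zeta> a b c (axis p (x mod int (m p))) (axis q (y mod int (m q))) (axis s (z mod int (m s)))"
    unfolding mon_axis_mod[OF assms(1), of x] mon_axis_mod[OF assms(2), of y] mon_axis_mod[OF assms(3), of z]
    by (intro omega axis_mod_exponents)
  then show ?thesis
    using cocycle_value_axis[OF assms, of "x mod int (m p)" m "y mod int (m q)" "z mod int (m s)" \<zeta> a b c]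
      m_pos[OF assms(1)] m_pos[OF assms(2)] m_pos[OF assms(3)] by (auto split: if_splits)
qed

lemma mon_axis_add: "mon (axis p x) \<otimes>\<^bsub>G\<^esub> mon (axis p y) = mon (axis p (x + y))"
  unfolding mon_mult by (rule mon_cong) (simp add: axis_def)

end

section \<open>Constraints on a quasi-bicharacter\<close>

context cyclic_product_cocycle
begin

context
  fixes R
  assumes R: "quasi_bicharacter G \<omega> R"
begin

lemma R_nz: "x \<in> carrier G \<Longrightarrow> y \<in> carrier G \<Longrightarrow> R x y \<noteq> 0"
  using R unfolding quasi_bicharacter_def by blast

lemma R_mult_left:
  assumes "x \<in> carrier G" "y \<in> carrier G" "z \<in> carrier G"
  shows "R (x \<otimes>\<^bsub>G\<^esub> y) z = R x z * R y z * (\<omega> x y z * \<omega> z x y / \<omega> x z y)"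
proof -
  have "R (x \<otimes>\<^bsub>G\<^esub> y) z / (R x z * R y z) * (\<omega> x z y / (\<omega> x y z * \<omega> z x y)) = 1"
    using R assms unfolding quasi_bicharacter_def by blast
  then show ?thesis
    using assms by (simp add: R_nz omega_nz field_simps del: carrier_product_group mult_product_group)
qed

lemma R_mult_right:
  assumes "x \<in> carrier G" "y \<in> carrier G" "z \<in> carrier G"
  shows "R x (y \<otimes>\<^bsub>G\<^esub> z) = R x y * R x z * (\<omega> y x z / (\<omega> x y z * \<omega> y z x))"
proof -
  have "1 = R x (y \<otimes>\<^bsub>G\<^esub> z) / (R x y * R x z) * (\<omega> x y z * \<omega> y z x / \<omega> y x z)"
    using R assms unfolding quasi_bicharacter_def by blast
  then show ?thesis
    using assms by (simp add: R_nz omega_nz field_simps del: carrier_product_group mult_product_group)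
qed

lemma mon_axis_period: "p \<in> {1..n} \<Longrightarrow> mon (axis p (int (m p))) = mon (axis p 0)"
  using mon_axis_mod[of p "int (m p)"] by simp

lemma R_axis_add_left:
  "R (mon (axis p (x + y))) (mon g) = R (mon (axis p x)) (mon g) * R (mon (axis p y)) (mon g) *
    (\<omega> (mon (axis p x)) (mon (axis p y)) (mon g) * \<omega> (mon g) (mon (axis p x)) (mon (axis p y)) /
     \<omega> (mon (axis p x)) (mon g) (mon (axis p y)))"
  unfolding mon_axis_add[symmetric] by (intro R_mult_left mon_closed)

lemma R_axis_add_right:
  "R (mon g) (mon (axis p (x + y))) = R (mon g) (mon (axis p x)) * R (mon g) (mon (axis p y)) *
    (\<omega> (mon (axis p x)) (mon g) (mon (axis p y)) /
     (\<omega> (mon g) (mon (axis p x)) (mon (axis p y)) * \<omega> (mon (axis p x)) (mon (axis p y)) (mon g)))"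
  unfolding mon_axis_add[symmetric] by (intro R_mult_right mon_closed)

text \<open>
  The cocycle is trivial as soon as one argument is the identity, so the two identities for
  \<open>1 = 1 \<cdot> 1\<close> make the value an idempotent of \<open>\<Bbbk>\<^sup>*\<close>.
\<close>

lemma R_unit_left:
  assumes "p \<in> {1..n}" "q \<in> {1..n}"
  shows "R (mon (axis p 0)) (mon (axis q y)) = 1"
  using R_axis_add_left[of p 0 0 "axis q y"] assms R_nz[OF mon_closed mon_closed]
  by (cases q p rule: linorder_cases) (simp_all add: omega_axis)

lemma R_unit_right:
  assumes "p \<in> {1..n}" "q \<in> {1..n}"
  shows "R (mon (axis q y)) (mon (axis p 0)) = 1"
  using R_axis_add_right[of "axis q y" p 0 0] assms R_nz[OF mon_closed mon_closed]
  by (cases q p rule: linorder_cases) (simp_all add: omega_axis)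

text \<open>
  In the correction for \<open>R(g\<^sub>p\<^sup>k g\<^sub>p, g\<^sub>q)\<close> the term \<open>\<omega>(g\<^sub>p\<^sup>k, g\<^sub>q, g\<^sub>p)\<close> cancels
  \<open>\<omega>(g\<^sub>p\<^sup>k, g\<^sub>p, g\<^sub>q)\<close> if \<open>q = p\<close> and is trivial otherwise. The \<open>a\<close>-term comes from
  \<open>\<omega>(g\<^sub>q, g\<^sub>p\<^sup>k, g\<^sub>p)\<close>, the \<open>b\<close>-term from \<open>\<omega>(g\<^sub>p\<^sup>k, g\<^sub>p, g\<^sub>q)\<close>.
\<close>

lemma R_power_left:
  assumes "p \<in> {1..n}" "q \<in> {1..n}"
  shows "R (mon (axis p 1)) (mon (axis q 1)) ^ m p *
    (if q = p then \<zeta> (m p) powi a p else if q < p then \<zeta> (m q) powi b q p else 1) = 1"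
proof (rule power_of_cyclic_recursion[where T = "\<lambda>k. R (mon (axis p (int k))) (mon (axis q 1))"])
  fix k assume k: "k < m p"
  note carry = powi_carry[OF m_dvd_le k zeta_1, of q q]
  have Suc: "int (Suc k) = int k + 1" by simp
  have "R (mon (axis p (int (Suc k)))) (mon (axis q 1)) =
      R (mon (axis p (int k))) (mon (axis q 1)) * R (mon (axis p 1)) (mon (axis q 1)) *
      (if q \<le> p then \<zeta> (m q) powi ((if q = p then a p else b q p) * (1 mod int (m q)) *
         ((int k mod int (m p) + 1 mod int (m p)) div int (m p))) else 1)"
    unfolding Suc R_axis_add_left
    using assms zeta_nz[of q] by (cases "q = p") (simp_all add: omega_axis)
  also have "\<dots> = R (mon (axis p (int k))) (mon (axis q 1)) * R (mon (axis p 1)) (mon (axis q 1)) *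
      (if Suc k = m p
       then if q = p then \<zeta> (m p) powi a p else if q < p then \<zeta> (m q) powi b q p else 1 else 1)"
    using carry assms by (cases "q \<le> p") (simp_all split: if_split)
  finally show "R (mon (axis p (int (Suc k)))) (mon (axis q 1)) = \<dots>" .
qed (use assms m_pos R_unit_left mon_axis_period in auto)

text \<open>
  On this side the cocycle enters inverted, so for \<open>q = p\<close> this relation is independent of that
  in \<open>R_power_left\<close>. A \<open>b\<close>-term would need \<open>q < p\<close>.
\<close>

lemma R_power_right:
  assumes "p \<in> {1..n}" "q \<in> {1..n}" "p \<le> q"
  shows "R (mon (axis q 1)) (mon (axis p 1)) ^ m p *
    (if q = p then inverse (\<zeta> (m p) powi a p) else 1) = 1"
proof (rule power_of_cyclic_recursion[where T = "\<lambda>k. R (mon (axis q 1)) (mon (axis p (int k)))"])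
  fix k assume k: "k < m p"
  note carry = powi_carry[OF m_dvd_le k zeta_1, of p p]
  have Suc: "int (Suc k) = int k + 1" by simp
  have "R (mon (axis q 1)) (mon (axis p (int (Suc k)))) =
      R (mon (axis q 1)) (mon (axis p (int k))) * R (mon (axis q 1)) (mon (axis p 1)) *
      (if q = p then inverse (\<zeta> (m p) powi (a p * (1 mod int (m p)) *
         ((int k mod int (m p) + 1 mod int (m p)) div int (m p)))) else 1)"
    unfolding Suc R_axis_add_right
    using assms zeta_nz[of p] by (cases "q = p") (simp_all add: omega_axis field_simps)
  also have "\<dots> = R (mon (axis q 1)) (mon (axis p (int k))) * R (mon (axis q 1)) (mon (axis p 1)) *
      (if Suc k = m p then if q = p then inverse (\<zeta> (m p) powi a p) else 1 else 1)"
    using carry assms by (cases "q = p") (simp_all split: if_split)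
  finally show "R (mon (axis q 1)) (mon (axis p (int (Suc k)))) = \<dots>" .
qed (use assms m_pos R_unit_right mon_axis_period in auto)

text \<open>
  Expand both sides of \<open>R(g\<^sub>t g\<^sub>s, g\<^sub>r) = R(g\<^sub>s g\<^sub>t, g\<^sub>r)\<close>: among the six cocycle values that occur
  only \<open>\<omega>(g\<^sub>t, g\<^sub>s, g\<^sub>r)\<close> can differ from \<open>1\<close>.
\<close>

lemma triple_root_eq_1:
  assumes "1 \<le> r" "r < s" "s < t" "t \<le> n"
  shows "\<zeta> (m r) powi c r s t = 1"
proof (cases "m r = 1")
  case False
  have rst: "r \<in> {1..n}" "s \<in> {1..n}" "t \<in> {1..n}" using assms by auto
  have "m r > 1" using m_pos[OF rst(1)] False by simp
  moreover have "m s \<ge> m r" "m t \<ge> m r"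
    using m_dvd_le[of r s] m_dvd_le[of r t] m_pos[OF rst(2)] m_pos[OF rst(3)] assms
    by (auto intro!: dvd_imp_le)
  ultimately have *: "\<omega> (mon (axis t 1)) (mon (axis s 1)) (mon (axis r 1)) = \<zeta> (m r) powi (- c r s t)"
    using rst assms by (auto simp: omega_axis)
  have "mon (axis t 1) \<otimes>\<^bsub>G\<^esub> mon (axis s 1) = mon (axis s 1) \<otimes>\<^bsub>G\<^esub> mon (axis t 1)"
    by (simp only: mon_mult add.commute)
  with R_mult_left[OF mon_closed mon_closed mon_closed, of "axis t 1" "axis s 1" "axis r 1"]
    R_mult_left[OF mon_closed mon_closed mon_closed, of "axis s 1" "axis t 1" "axis r 1"]
  have "\<zeta> (m r) powi (- c r s t) = 1"
    using rst assms R_nz[OF mon_closed mon_closed]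
    by (simp add: * omega_axis del: mult_product_group)
  then show ?thesis by (simp add: power_int_minus)
next
  case True
  show ?thesis by (simp only: zeta_1[OF True] power_int_1_left)
qed

end

end

section \<open>Construction of a quasi-bicharacter\<close>

context cyclic_product_cocycle
begin

lemma bicharacter_exists:
  fixes \<rho> :: "nat \<Rightarrow> nat \<Rightarrow> 'k"
  assumes rho_nz: "\<And>i j. i \<in> {1..n} \<Longrightarrow> j \<in> {1..n} \<Longrightarrow> \<rho> i j \<noteq> 0"
    and diag: "\<And>i. i \<in> {1..n} \<Longrightarrow> \<rho> i i ^ m i = \<zeta> (m i) powi a i"
    and sign: "\<And>i. i \<in> {1..n} \<Longrightarrow> (\<zeta> (m i) powi a i)^2 = 1"
    and off: "\<And>i j. i \<in> {1..n} \<Longrightarrow> j \<in> {1..n} \<Longrightarrow> i \<noteq> j \<Longrightarrow> \<rho> i j ^ m i = 1 \<and> \<rho> i j ^ m j = 1"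
    and b0: "\<And>i j. 1 \<le> i \<Longrightarrow> i < j \<Longrightarrow> j \<le> n \<Longrightarrow> b i j = 0"
    and c0: "\<And>r s t. 1 \<le> r \<Longrightarrow> r < s \<Longrightarrow> s < t \<Longrightarrow> t \<le> n \<Longrightarrow> c r s t = 0"
  shows "\<exists>R. quasi_bicharacter G \<omega> R \<and>
              (\<forall>i\<in>{1..n}. \<forall>j\<in>{1..n}. R (factor_gen n m u i) (factor_gen n m u j) = \<rho> i j)"
proof -
  \<comment> \<open>\<open>L\<close> picks some exponents of a group element and \<open>W\<close> reduces them, which makes the choice
    immaterial in positions \<open>1, \<dots>, n\<close>. \<open>Q e f g\<close> is the value of the cocycle, written so that its
    \<open>i\<close>-th factor is a power of \<open>\<rho> i i ^ m i\<close>.\<close>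
  define L where "L x = (SOME e. x = mon e)" for x
  define B where "B e f = (\<Prod>i\<in>{1..n}. \<Prod>j\<in>{1..n}. \<rho> i j powi (e i * f j))" for e f :: "nat \<Rightarrow> int"
  define Q where "Q e f g = (\<Prod>i\<in>{1..n}. (\<zeta> (m i) powi a i) powi (((f i + g i) div int (m i)) * e i))"
    for e f g :: "nat \<Rightarrow> int"
  define W where "W e = (\<lambda>j. e j mod int (m j))" for e :: "nat \<Rightarrow> int"
  define R where "R x y = B (W (L x)) (W (L y))" for x y
  have WL: "W (L (mon e)) j = e j mod int (m j)" if "j \<in> {1..n}" for e j
  proof -
    have "mon e = mon (L (mon e))"
      unfolding L_def by (rule someI[where P = "\<lambda>f. mon e = mon f"]) (rule refl)
    from mon_inj[OF this that] show ?thesis by (simp add: W_def)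
  qed
  have R_mon: "R (mon e) (mon f) = B (W e) (W f)" for e f
    unfolding R_def B_def by (simp add: WL) (simp add: W_def)
  have W_exp: "W e j = e j" if "e \<in> exponents n m" "j \<in> {1..n}" for e j
    using that by (auto simp: exponents_def W_def)
  have B_W: "B (W e) (W f) = B e f" if "e \<in> exponents n m" "f \<in> exponents n m" for e f
    unfolding B_def using W_exp that by simp
  have B_nz: "B e f \<noteq> 0" for e f
    unfolding B_def using rho_nz by simp
  have Q_nz: "Q e f g \<noteq> 0" for e f g
    unfolding Q_def using zeta_nz by simp
  have Q_sq: "Q e f g * Q e f g = 1" for e f g
  proof -
    have "(\<zeta> (m i) powi a i) powi k * (\<zeta> (m i) powi a i) powi k = 1" if "i \<in> {1..n}" for i k
      using sign[OF that] by (simp add: power_int_mult_distrib[symmetric] power2_eq_square)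
    then show ?thesis
      unfolding Q_def prod.distrib[symmetric] by simp
  qed
  have omega_Q: "\<omega> (mon e) (mon f) (mon g) = Q e f g"
    if "e \<in> exponents n m" "f \<in> exponents n m" "g \<in> exponents n m" for e f g
  proof -
    have "\<zeta> (m r) powi (a r * e r * ((f r + g r) div int (m r))) =
          (\<zeta> (m r) powi a r) powi (((f r + g r) div int (m r)) * e r)" for r
      by (simp add: power_int_mult[symmetric] mult_ac)
    then show ?thesis
      using that b0 c0 by (simp add: omega cocycle_value_def Q_def)
  qed
  \<comment> \<open>As a double product with trivial off-diagonal factors, \<open>Q\<close> can be compared with \<open>B\<close> factor by factor.\<close>
  have Q_double: "Q g e f = (\<Prod>i\<in>{1..n}. \<Prod>j\<in>{1..n}.
      if i = j then (\<zeta> (m i) powi a i) powi (((e i + f i) div int (m i)) * g i) else 1)" for e f g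
    unfolding Q_def by (intro prod.cong) (auto simp: prod.delta')
  have B_left: "B (W (\<lambda>j. e j + f j)) g = B e g * B f g / Q g e f" for e f g
  proof -
    have "\<rho> i j powi (W (\<lambda>j. e j + f j) i * g j) = \<rho> i j powi (e i * g j) * \<rho> i j powi (f i * g j) /
          (if i = j then (\<zeta> (m i) powi a i) powi (((e i + f i) div int (m i)) * g i) else 1)"
      if "i \<in> {1..n}" "j \<in> {1..n}" for i j
      unfolding W_def powi_mod_mult[OF rho_nz[OF that]]
      using rho_nz[OF that] diag[OF that(1)] off[OF that]
      by (auto simp: distrib_right power_int_add)
    then show ?thesis
      unfolding B_def Q_double prod.distrib[symmetric] prod_dividef[symmetric]
      by (intro prod.cong refl) blast
  qed
  have B_right: "B g (W (\<lambda>j. e j + f j)) = B g e * B g f / Q g e f" for e f g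
  proof -
    have "\<rho> i j powi (g i * W (\<lambda>j. e j + f j) j) = \<rho> i j powi (g i * e j) * \<rho> i j powi (g i * f j) /
          (if i = j then (\<zeta> (m i) powi a i) powi (((e i + f i) div int (m i)) * g i) else 1)"
      if "i \<in> {1..n}" "j \<in> {1..n}" for i j
      unfolding W_def mult.commute[of "g i"] powi_mod_mult[OF rho_nz[OF that]]
      using rho_nz[OF that] diag[OF that(1)] off[OF that]
      by (auto simp: distrib_right power_int_add)
    then show ?thesis
      unfolding B_def Q_double prod.distrib[symmetric] prod_dividef[symmetric]
      by (intro prod.cong refl) blast
  qed
  have Q_comm: "Q e f g = Q e g f" for e f g
    by (simp add: Q_def add.commute)
  have "quasi_bicharacter G \<omega> R"
    unfolding quasi_bicharacter_def
  proof (intro conjI ballI)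
    show "R x y \<noteq> 0" for x y
      unfolding R_def by (rule B_nz)
  next
    fix x y z assume "x \<in> carrier G" "y \<in> carrier G" "z \<in> carrier G"
    then obtain e f g where E: "e \<in> exponents n m" "f \<in> exponents n m" "g \<in> exponents n m"
      and xyz: "x = mon e" "y = mon f" "z = mon g"
      using mon_surj by metis
    have R1: "R (x \<otimes>\<^bsub>G\<^esub> y) z = B e g * B f g / Q g e f"
      unfolding xyz mon_mult R_mon B_left[symmetric] using W_exp[OF E(3)] by (simp add: B_def)
    have R2: "R x (y \<otimes>\<^bsub>G\<^esub> z) = B e f * B e g / Q e f g"
      unfolding xyz mon_mult R_mon B_right[symmetric] using W_exp[OF E(1)] by (simp add: B_def)
    show "R (x \<otimes>\<^bsub>G\<^esub> y) z / (R x z * R y z) * (\<omega> x z y / (\<omega> x y z * \<omega> z x y)) = 1"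
      unfolding R1 unfolding xyz R_mon
      using E Q_sq[of g e f] by (simp add: B_W omega_Q B_nz Q_nz Q_comm[of e g f] field_simps)
    show "1 = R x (y \<otimes>\<^bsub>G\<^esub> z) / (R x y * R x z) * (\<omega> x y z * \<omega> y z x / \<omega> y x z)"
      unfolding R2 unfolding xyz R_mon
      using E by (simp add: B_W omega_Q B_nz Q_nz Q_comm[of f g e])
  qed
  moreover have "R (factor_gen n m u i) (factor_gen n m u j) = \<rho> i j"
    if ij: "i \<in> {1..n}" "j \<in> {1..n}" for i j
  proof -
    have val: "B (axis i x) (axis j y) = \<rho> i j powi (x * y)" for x y
    proof -
      have "\<rho> k l powi (axis i x k * axis j y l) =
          (if l = j \<and> k = i then \<rho> i j powi (x * y) else 1)" for k l
        by (simp add: axis_def)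
      then have "B (axis i x) (axis j y) = (\<Prod>k\<in>{1..n}. if k = i \<and> True then \<rho> i j powi (x * y) else 1)"
        unfolding B_def using ij by (simp only: prod_if_eq_1 finite_atLeastAtMost) simp
      then show ?thesis using ij by (simp only: prod_if_eq_1 finite_atLeastAtMost) simp
    qed
    have W_axis: "W (axis k 1) = axis k (1 mod int (m k))" for k
      by (auto simp: W_def axis_def)
    \<comment> \<open>If a factor is trivial, its generator has reduced exponent \<open>0\<close>, not \<open>1\<close>, and \<open>R\<close> takes
      the value \<open>1\<close> there; the hypotheses make \<open>\<rho> i j\<close> equal to \<open>1\<close> as well.\<close>
    have one: "\<rho> i j = 1" if "m i = 1 \<or> m j = 1"
    proof (cases "i = j")
      case True
      then show ?thesis using that diag[OF ij(1)] zeta_1[of i] by auto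
    next
      case False
      then show ?thesis using that off[OF ij] by auto
    qed
    have "R (factor_gen n m u i) (factor_gen n m u j) = \<rho> i j powi ((1 mod int (m i)) * (1 mod int (m j)))"
      using ij by (simp add: factor_gen_eq_mon R_mon W_axis val)
    also have "\<dots> = \<rho> i j"
    proof (cases "m i = 1 \<or> m j = 1")
      case True
      then show ?thesis using one by simp
    next
      case False
      then have "m i > 1" "m j > 1" using m_pos[OF ij(1)] m_pos[OF ij(2)] by auto
      then show ?thesis by simp
    qed
    finally show ?thesis .
  qed
  ultimately show ?thesis by blast
qed

end

section \<open>The characterisation\<close>

theorem proposition3p2:
  fixes \<zeta> :: "nat \<Rightarrow> 'k :: {alg_closed_field, field_char_0}"
    and n :: nat and m :: "nat \<Rightarrow> nat" and u :: "nat \<Rightarrow> int"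
    and a :: "nat \<Rightarrow> int" and b :: "nat \<Rightarrow> nat \<Rightarrow> int" and c :: "nat \<Rightarrow> nat \<Rightarrow> nat \<Rightarrow> int"
    and \<omega> :: "(nat \<Rightarrow> int) \<Rightarrow> (nat \<Rightarrow> int) \<Rightarrow> (nat \<Rightarrow> int) \<Rightarrow> 'k"
    and \<rho> :: "nat \<Rightarrow> nat \<Rightarrow> 'k"
  assumes zeta: "\<And>l. l > 0 \<Longrightarrow> primitive_root_of_unity l (\<zeta> l)"
    and m_pos: "\<And>i. 1 \<le> i \<Longrightarrow> i \<le> n \<Longrightarrow> m i > 0"
    and m_dvd: "\<And>i. 1 \<le> i \<Longrightarrow> i < n \<Longrightarrow> m i dvd m (i + 1)"
    and gens: "is_factor_gens n m u"
    and a_range: "\<And>r. 1 \<le> r \<Longrightarrow> r \<le> n \<Longrightarrow> 0 \<le> a r \<and> a r < int (m r)"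
    and b_range: "\<And>r s. 1 \<le> r \<Longrightarrow> r < s \<Longrightarrow> s \<le> n \<Longrightarrow> 0 \<le> b r s \<and> b r s < int (m r)"
    and c_range: "\<And>r s t. 1 \<le> r \<Longrightarrow> r < s \<Longrightarrow> s < t \<Longrightarrow> t \<le> n \<Longrightarrow>
                    0 \<le> c r s t \<and> c r s t < int (m r)"
    and omega: "\<And>i j k. i \<in> exponents n m \<Longrightarrow> j \<in> exponents n m \<Longrightarrow> k \<in> exponents n m \<Longrightarrow>
                  \<omega> (gen_monomial n m u i) (gen_monomial n m u j) (gen_monomial n m u k) =
                    cocycle_value n m \<zeta> a b c i j k"
    and rho_nz: "\<And>i j. 1 \<le> i \<Longrightarrow> i \<le> n \<Longrightarrow> 1 \<le> j \<Longrightarrow> j \<le> n \<Longrightarrow> \<rho> i j \<noteq> 0"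
  shows "(\<exists>R. quasi_bicharacter (cyclic_product n m) \<omega> R \<and>
              (\<forall>i\<in>{1..n}. \<forall>j\<in>{1..n}. R (factor_gen n m u i) (factor_gen n m u j) = \<rho> i j))
    \<longleftrightarrow>
         (\<forall>i\<in>{1..n}. \<rho> i i ^ m i = \<zeta> (m i) powi a i \<and>
                      \<zeta> (m i) powi a i = \<zeta> (m i) powi (- a i)) \<and>
         (\<forall>i\<in>{1..n}. \<forall>j\<in>{i<..n}. \<rho> i j ^ m i = 1 \<and> \<rho> j i ^ m i = 1 \<and> b i j = 0) \<and>
         (\<forall>r\<in>{1..n}. \<forall>s\<in>{r<..n}. \<forall>t\<in>{s<..n}. c r s t = 0)"
proof -
  interpret cyclic_product_cocycle n m u \<zeta> a b c \<omega>
    by unfold_locales (use zeta m_pos m_dvd gens omega in auto)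
  show ?thesis (is "?L \<longleftrightarrow> ?D \<and> ?O \<and> ?C")
  proof
    assume ?L
    then obtain R where R: "quasi_bicharacter G \<omega> R"
      and val: "\<And>i j. i \<in> {1..n} \<Longrightarrow> j \<in> {1..n} \<Longrightarrow> R (mon (axis i 1)) (mon (axis j 1)) = \<rho> i j"
      by (auto simp: factor_gen_eq_mon)
    have D: ?D
    proof
      fix i assume i: "i \<in> {1..n}"
      have "\<rho> i i ^ m i * \<zeta> (m i) powi a i = 1"
        using R_power_left[OF R i i] i by (simp add: val)
      moreover have "\<rho> i i ^ m i * inverse (\<zeta> (m i) powi a i) = 1"
        using R_power_right[OF R i i] i by (simp add: val)
      ultimately show "\<rho> i i ^ m i = \<zeta> (m i) powi a i \<and> \<zeta> (m i) powi a i = \<zeta> (m i) powi (- a i)"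
        using zeta_nz[OF i] by (simp add: power_int_minus field_simps)
    qed
    have O: ?O
    proof (intro ballI)
      fix i j assume "i \<in> {1..n}" "j \<in> {i<..n}"
      then have ij: "i \<in> {1..n}" "j \<in> {1..n}" "i < j" by auto
      have 1: "\<rho> i j ^ m i = 1"
        using R_power_left[OF R ij(1,2)] ij by (simp add: val)
      have 2: "\<rho> j i ^ m i = 1"
        using R_power_right[OF R ij(1,2)] ij by (simp add: val)
      \<comment> \<open>Divisibility turns the relation at order \<open>m i\<close> into one at order \<open>m j\<close>, the order at which
        \<open>R_power_left\<close> involves \<open>b i j\<close>.\<close>
      have "m i dvd m j" using m_dvd_le ij by simp
      then have "\<rho> j i ^ m j = 1"
        using 2 by (auto simp: power_mult elim!: dvdE)
      then have "\<zeta> (m i) powi b i j = 1"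
        using R_power_left[OF R ij(2,1)] ij by (simp add: val)
      then have "b i j = 0"
        using primitive_root_powi_eq_1D[OF zeta] m_pos[of i] b_range[of i j] ij by auto
      with 1 2 show "\<rho> i j ^ m i = 1 \<and> \<rho> j i ^ m i = 1 \<and> b i j = 0" by blast
    qed
    have C: ?C
    proof (intro ballI)
      fix r s t assume "r \<in> {1..n}" "s \<in> {r<..n}" "t \<in> {s<..n}"
      then have rst: "1 \<le> r" "r < s" "s < t" "t \<le> n" by auto
      show "c r s t = 0"
        using primitive_root_powi_eq_1D[OF zeta _ _ triple_root_eq_1[OF R rst]] c_range[OF rst] m_pos[of r] rst
        by auto
    qed
    show "?D \<and> ?O \<and> ?C" using D O C by blast
  next
    assume A: "?D \<and> ?O \<and> ?C"
    show ?L
    proof (rule bicharacter_exists)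
      fix i j assume ij: "i \<in> {1..n}" "j \<in> {1..n}"
      show "\<rho> i j \<noteq> 0" using rho_nz ij by auto
      assume "i \<noteq> j"
      have *: "x ^ m l = 1" if "x ^ m k = 1" "k \<in> {1..n}" "l \<in> {1..n}" "k < l" for x :: 'k and k l
      proof -
        have "m k dvd m l" using m_dvd_le that by simp
        then show ?thesis using that(1) by (auto simp: power_mult elim!: dvdE)
      qed
      show "\<rho> i j ^ m i = 1 \<and> \<rho> i j ^ m j = 1"
        using A ij \<open>i \<noteq> j\<close> *[of "\<rho> i j" i j] *[of "\<rho> i j" j i] by (cases "i < j") auto
    next
      fix i assume i: "i \<in> {1..n}"
      show "\<rho> i i ^ m i = \<zeta> (m i) powi a i" using A i by blast
      have "\<zeta> (m i) powi a i = inverse (\<zeta> (m i) powi a i)"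
        using A i by (metis power_int_minus)
      then show "(\<zeta> (m i) powi a i)\<^sup>2 = 1"
        using zeta_nz[OF i] by (metis power2_eq_square power_int_not_zero right_inverse)
    qed (use A in auto)
  qed
qed

end
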